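(* Let $\mathcal{R}=\{1,\dots,n\}$ be a route set with durations $l_i\in\mathbb{R}$, and let $T>0$, $\beta>0$. Let $y$ be an optimal solution of $$\min\ \frac1T\sum_{i\in\mathcal{R}}\left(\frac12y_i^2+l_iy_i+\frac{y_i}{\beta}\log\left(\frac{1-e^{-\beta y_i}}{1-e^{-\beta T}}\right)\right)\quad\text{s.t.}\quad\sum_{i\in\mathcal{R}}y_i=T,\quad y_i\ge0\ \ \forall i\in\mathcal{R}.$$ Let $\boldsymbol{\theta}$ be the timetable produced from $y$ by the procedure TimeTableLogit. Then $\boldsymbol{\theta}$ is an optimal timetable for logit routing, i.e. it minimizes $\mathcal{M}^{TT}_{logit}(\mathcal{R},T,\cdot)$ over all timetables in $[0,T)^n$, and $\mathcal{M}^{TT}_{logit}(\mathcal{R},T,\boldsymbol{\theta})$ equals the optimal objective value $$\min\left\{\frac1T\sum_{i\in\mathcal{R}}\left(\frac12u_i^2+l_iu_i+\frac{u_i}{\beta}\log\left(\frac{1-e^{-\beta u_i}}{1-e^{-\beta T}}\right)\right)\ :\ \sum_{i\in\mathcal{R}}u_i=T,\ u_i\ge0\ \ \forall i\in\mathcal{R}\right\}.$$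
   Context: In the objective, the term $\frac{y_i}{\beta}\log(\cdot)$ is taken to be $0$ when $y_i=0$. Procedure TimeTableLogit: given $y$, set $\hat\Delta_i=y_i$ and $\hat\tau_i=l_i+\frac1\beta\log\left(\frac{1-e^{-\beta\hat\Delta_i}}{1-e^{-\beta T}}\right)$ for all $i\in\mathcal{R}$; set $\theta_1=0$ and, for $i=2,\dots,n$, set $\hat\delta_i=\hat\tau_{i-1}+\hat\Delta_{i-1}-\hat\tau_i$ and $\theta_i=\theta_{i-1}+\hat\delta_i$; return $\boldsymbol{\theta}=(\theta_1,\dots,\theta_n)$. A timetable assigns to each route $i$ a departure time $\theta_i\in[0,T)$; route $i$ departs at times $\theta_i+zT$, $z\in\mathbb{Z}$. For $x\in\mathbb{R}$, $[x]_T$ denotes the element of $[0,T)$ differing from $x$ by an integer multiple of $T$. The timetable measure for logit routing (under uniform demand) is $$\mathcal{M}^{TT}_{logit}(\mathcal{R},T,\boldsymbol{\theta})=\mathbb{E}_t\left(-\frac1\beta\log\left(\sum_{i\in\mathcal{R}}e^{-\beta(l_i+[\theta_i-t]_T)}\right)\right),$$ with $t$ uniformly distributed on $[0,T)$. *)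

theory Defs
  imports "HOL-Probability.Probability" "HOL-Library.Real_Mod"
begin

text \<open>
  Routes are \<open>1, \<dots>, n\<close>; durations, departure times and the variables of the optimization problem
  are functions on \<^typ>\<open>nat\<close> of which only the values on \<open>{1..n}\<close> matter.
\<close>

definition timetables :: "nat \<Rightarrow> real \<Rightarrow> (nat \<Rightarrow> real) set" where
  "timetables n T = {1..n} \<rightarrow> {0..<T}"

text \<open>For \<open>T > 0\<close>, \<open>x rmod T\<close> is the element of \<open>{0..<T}\<close> differing from \<open>x\<close> by an integer
  multiple of \<open>T\<close>, see \<open>rmod_unique\<close>.\<close>

definition logit_cost :: "nat \<Rightarrow> real \<Rightarrow> real \<Rightarrow> (nat \<Rightarrow> real) \<Rightarrow> (nat \<Rightarrow> real) \<Rightarrow> real \<Rightarrow> real" where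
  "logit_cost n T \<beta> l \<theta> t =
     - (1 / \<beta>) * ln (\<Sum>i\<in>{1..n}. exp (- \<beta> * (l i + (\<theta> i - t) rmod T)))"

definition logit_measure :: "nat \<Rightarrow> real \<Rightarrow> real \<Rightarrow> (nat \<Rightarrow> real) \<Rightarrow> (nat \<Rightarrow> real) \<Rightarrow> real" where
  "logit_measure n T \<beta> l \<theta> =
     prob_space.expectation (uniform_measure lborel {0..<T}) (logit_cost n T \<beta> l \<theta>)"

definition feasible :: "nat \<Rightarrow> real \<Rightarrow> (nat \<Rightarrow> real) set" where
  "feasible n T = {u. (\<Sum>i\<in>{1..n}. u i) = T \<and> (\<forall>i\<in>{1..n}. u i \<ge> 0)}"

definition objective :: "nat \<Rightarrow> real \<Rightarrow> real \<Rightarrow> (nat \<Rightarrow> real) \<Rightarrow> (nat \<Rightarrow> real) \<Rightarrow> real" where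
  "objective n T \<beta> l u =
     1 / T * (\<Sum>i\<in>{1..n}. 1 / 2 * (u i)\<^sup>2 + l i * u i
       + (if u i = 0 then 0
          else u i / \<beta> * ln ((1 - exp (- \<beta> * u i)) / (1 - exp (- \<beta> * T)))))"

text \<open>
  The logarithm below has a positive argument only if \<open>y i > 0\<close>. An optimal \<open>y\<close> satisfies this for
  every route, because the derivative of the objective with respect to \<open>y i\<close> tends to \<open>-\<infinity>\<close>
  as \<open>y i\<close> tends to \<open>0\<close>; so the value \<open>ln 0 = 0\<close> plays no role.
\<close>

definition tau_hat :: "real \<Rightarrow> real \<Rightarrow> (nat \<Rightarrow> real) \<Rightarrow> (nat \<Rightarrow> real) \<Rightarrow> nat \<Rightarrow> real" where
  "tau_hat T \<beta> l y i =
     l i + 1 / \<beta> * ln ((1 - exp (- \<beta> * y i)) / (1 - exp (- \<beta> * T)))"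

definition delta_hat :: "real \<Rightarrow> real \<Rightarrow> (nat \<Rightarrow> real) \<Rightarrow> (nat \<Rightarrow> real) \<Rightarrow> nat \<Rightarrow> real" where
  "delta_hat T \<beta> l y i = tau_hat T \<beta> l y (i - 1) + y (i - 1) - tau_hat T \<beta> l y i"

text \<open>Index \<open>0\<close> is not a route; its value is a dummy.\<close>

fun time_table_logit :: "real \<Rightarrow> real \<Rightarrow> (nat \<Rightarrow> real) \<Rightarrow> (nat \<Rightarrow> real) \<Rightarrow> nat \<Rightarrow> real" where
  "time_table_logit T \<beta> l y 0 = 0"
| "time_table_logit T \<beta> l y (Suc 0) = 0"
| "time_table_logit T \<beta> l y (Suc (Suc k)) =
     time_table_logit T \<beta> l y (Suc k) + delta_hat T \<beta> l y (Suc (Suc k))"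

end

theory Submission
  imports Defs "HOL-Real_Asymp.Real_Asymp"
begin

text \<open>
  Between two departures every waiting time \<open>[\<theta> i - t]\<close> falls at unit rate, so the logit cost
  \<open>V t\<close> falls at unit rate as well. A departure of route \<open>i\<close> raises one waiting time from \<open>0\<close> to
  \<open>T\<close> and makes \<open>V\<close> jump up by some \<open>\<Delta> i > 0\<close>. Comparing the exponential sums on both sides of
  the jump determines the value of \<open>V\<close> just before it: it is
  \<open>l i + 1 / \<beta> * ln ((1 - exp (- \<beta> * \<Delta> i)) / (1 - exp (- \<beta> * T)))\<close>, which is the quantity
  \<open>tau_hat\<close> at \<open>\<Delta>\<close>. As \<open>V\<close> is periodic, the jumps add up to \<open>T\<close>, so \<open>\<Delta>\<close> is feasible. The
  area under the descent from one departure to the next is half a difference of squares; summed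
  over one period these areas are
  \<open>\<Sum>i. ((tau_hat i + \<Delta> i)\<^sup>2 - (tau_hat i)\<^sup>2) / 2 = \<Sum>i. (\<Delta> i)\<^sup>2 / 2 + \<Delta> i * tau_hat i\<close>,
  that is, \<open>T\<close> times the objective at \<open>\<Delta>\<close>. Hence the measure of \<^emph>\<open>every\<close> timetable is the
  objective value of a feasible point (\<open>logit_measure_attained_by_feasible\<close>), and no timetable
  beats the minimum.

  It remains to see that the timetable built from an optimal \<open>y\<close> has the jumps \<open>y\<close>
  (\<open>logit_measure_time_table_logit\<close>). The procedure spaces the departures such that a sawtooth
  with jumps \<open>y i\<close> starting from height \<open>tau_hat i\<close> closes up, which forces it to be the logit cost,
  provided that the departures occur in the order \<open>1, \<dots>, n\<close> within one period. This order is where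
  optimality enters: the objective has slope \<open>-\<infinity>\<close> at \<open>y i = 0\<close>, so all \<open>y i\<close> are
  positive, and then all partial derivatives \<open>tau_hat i + markup (y i)\<close> agree, where
  \<open>markup u = u / (1 - exp (- \<beta> * u))\<close> lies strictly between \<open>1 / \<beta>\<close> and \<open>u + 1 / \<beta>\<close>. The gap
  between the departures \<open>i\<close> and \<open>i + 1\<close> is \<open>markup (y (i + 1)) - markup (y i) + y i > 0\<close>, and
  the same bounds keep the last departure below \<open>T\<close>.
\<close>

section \<open>The sawtooth shape of the expected cost\<close>

text \<open>
  Adding \<open>t\<close> to the logit cost removes its unit rate of descent and leaves a function that changes
  only at departures. Its value depends only on the set \<open>D\<close> of routes that have already departed in
  the current period. Taking \<open>D\<close> as the parameter, rather than \<open>t\<close>, allows simultaneous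
  departures to be separated and treated one after the other.
\<close>

definition level :: "real \<Rightarrow> real \<Rightarrow> (nat \<Rightarrow> real) \<Rightarrow> (nat \<Rightarrow> real) \<Rightarrow> nat set \<Rightarrow> nat set \<Rightarrow> real" where
  "level T \<beta> l \<theta> I D =
     - (1 / \<beta>) * ln (\<Sum>i\<in>I. exp (- \<beta> * (l i + \<theta> i + (if i \<in> D then T else 0))))"

lemma exp_level:
  assumes "\<beta> > 0" "finite I" "I \<noteq> {}"
  shows "exp (- \<beta> * level T \<beta> l \<theta> I D) =
    (\<Sum>i\<in>I. exp (- \<beta> * (l i + \<theta> i + (if i \<in> D then T else 0))))"
proof -
  have "(\<Sum>i\<in>I. exp (- \<beta> * (l i + \<theta> i + (if i \<in> D then T else 0)))) > 0"
    using assms by (intro sum_pos) auto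
  then show ?thesis
    using assms unfolding level_def by simp
qed

lemma level_eqI:
  assumes "\<beta> > 0"
    and "(\<Sum>i\<in>I. exp (- \<beta> * (l i + \<theta> i + (if i \<in> D then T else 0)))) = exp (- \<beta> * c)"
  shows "level T \<beta> l \<theta> I D = c"
  using assms unfolding level_def by simp

text \<open>
  Once all routes have departed, every waiting time has been shifted by the same amount \<open>T\<close>. This is
  the reason why the jumps in one period add up to \<open>T\<close>.
\<close>

lemma level_all:
  assumes "\<beta> > 0" "finite I" "I \<noteq> {}"
  shows "level T \<beta> l \<theta> I I = level T \<beta> l \<theta> I {} + T"
proof (rule level_eqI[OF assms(1)])
  have "(\<Sum>i\<in>I. exp (- \<beta> * (l i + \<theta> i + (if i \<in> I then T else 0)))) =
      exp (- \<beta> * T) * (\<Sum>i\<in>I. exp (- \<beta> * (l i + \<theta> i)))"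
    by (auto simp: sum_distrib_left exp_add[symmetric] algebra_simps intro!: sum.cong)
  also have "\<dots> = exp (- \<beta> * T) * exp (- \<beta> * level T \<beta> l \<theta> I {})"
    using exp_level[OF assms, of T l \<theta> "{}"] by simp
  also have "\<dots> = exp (- \<beta> * (level T \<beta> l \<theta> I {} + T))"
    by (simp add: exp_add[symmetric] algebra_simps)
  finally show "(\<Sum>i\<in>I. exp (- \<beta> * (l i + \<theta> i + (if i \<in> I then T else 0)))) =
      exp (- \<beta> * (level T \<beta> l \<theta> I {} + T))" .
qed

lemma rmod_departure:
  assumes "a \<in> {0..<T}" "t \<in> {0..<T}"
  shows "(a - t) rmod T = a - t + (if a < t then T else 0)"
  by (rule rmod_unique[of _ _ _ "if a < t then -1 else 0"]) (use assms in \<open>auto split: if_splits\<close>)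

lemma logit_cost_eq_level:
  assumes "\<beta> > 0" "n \<noteq> 0" "\<theta> \<in> timetables n T" "t \<in> {0..<T}"
  shows "logit_cost n T \<beta> l \<theta> t = level T \<beta> l \<theta> {1..n} {i\<in>{1..n}. \<theta> i < t} - t"
proof -
  let ?D = "{i\<in>{1..n}. \<theta> i < t}"
  have "(\<Sum>i\<in>{1..n}. exp (- \<beta> * (l i + (\<theta> i - t) rmod T))) =
      exp (\<beta> * t) * (\<Sum>i\<in>{1..n}. exp (- \<beta> * (l i + \<theta> i + (if i \<in> ?D then T else 0))))"
    unfolding sum_distrib_left
  proof (intro sum.cong refl)
    fix i assume i: "i \<in> {1..n}"
    then have "\<theta> i \<in> {0..<T}"
      using assms(3) by (auto simp: timetables_def)
    then have "(\<theta> i - t) rmod T = \<theta> i - t + (if i \<in> ?D then T else 0)"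
      using rmod_departure[of "\<theta> i", OF _ assms(4)] i by simp
    then show "exp (- \<beta> * (l i + (\<theta> i - t) rmod T)) =
        exp (\<beta> * t) * exp (- \<beta> * (l i + \<theta> i + (if i \<in> ?D then T else 0)))"
      by (simp only: exp_add[symmetric]) (simp add: algebra_simps)
  qed
  also have "\<dots> = exp (\<beta> * t) * exp (- \<beta> * level T \<beta> l \<theta> {1..n} ?D)"
    using exp_level[OF assms(1), of "{1..n}" T l \<theta> ?D] assms(2) by simp
  also have "\<dots> = exp (- \<beta> * (level T \<beta> l \<theta> {1..n} ?D - t))"
    by (simp add: exp_add[symmetric] algebra_simps)
  finally show ?thesis
    using assms(1) by (simp add: logit_cost_def)
qed

lemma borel_measurable_logit_cost: "logit_cost n T \<beta> l \<theta> \<in> borel_measurable borel"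
  unfolding logit_cost_def[abs_def] rmod_def by measurable

lemma logit_measure_eq_integral:
  assumes "T > 0"
  shows "logit_measure n T \<beta> l \<theta> =
    (\<integral>t. indicator {0..<T} t * logit_cost n T \<beta> l \<theta> t \<partial>lborel) / T"
proof -
  have density: "uniform_measure lborel {0..<T} = density lborel (\<lambda>t. ennreal (indicator {0..<T} t / T))"
    unfolding uniform_measure_def using assms
    by (intro density_cong) (auto simp: divide_ennreal[symmetric] ennreal_indicator)
  show ?thesis
    unfolding logit_measure_def density
    using borel_measurable_logit_cost assms by (subst integral_density) auto
qed

lemma has_bochner_integral_sawtooth:
  fixes T :: real
  assumes "T > 0" "\<And>k. k \<in> I \<Longrightarrow> \<theta> k \<in> {0..<T}"
  shows "has_bochner_integral lborel
    (\<lambda>t. indicator {0..<T} t * (a - t + (\<Sum>k\<in>I. if \<theta> k < t then \<Delta> k else 0)))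
    (a * T - T\<^sup>2 / 2 + (\<Sum>k\<in>I. \<Delta> k * (T - \<theta> k)))"
proof -
  have jump: "has_bochner_integral lborel (\<lambda>t. \<Delta> k * indicator {\<theta> k<..<T} t) (\<Delta> k * (T - \<theta> k))"
    if "k \<in> I" for k
    using assms(2)[OF that]
    by (intro has_bochner_integral_mult_right) (auto simp: has_bochner_integral_iff)
  have const: "has_bochner_integral lborel (\<lambda>t. a * indicator {0..<T} t) (a * T)"
    using assms by (intro has_bochner_integral_mult_right) (auto simp: has_bochner_integral_iff)
  have "has_bochner_integral lborel (\<lambda>t. t * indicator {0..T} t) (T\<^sup>2 / 2 - 0\<^sup>2 / 2)"
    by (rule has_bochner_integral_FTC_Icc_real[where F = "\<lambda>t. t\<^sup>2 / 2"])
       (use assms in \<open>auto intro!: derivative_eq_intros\<close>)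
  moreover have "AE t in lborel. t * indicator {0..T} t = t * indicator {0..<T} t"
    using AE_lborel_singleton[of T] by eventually_elim (auto simp: indicator_def)
  ultimately have "has_bochner_integral lborel (\<lambda>t. t * indicator {0..<T} t) (T\<^sup>2 / 2)"
    by (subst has_bochner_integral_cong_AE[symmetric]) simp_all
  then have "has_bochner_integral lborel
    (\<lambda>t. a * indicator {0..<T} t - t * indicator {0..<T} t + (\<Sum>k\<in>I. \<Delta> k * indicator {\<theta> k<..<T} t))
    (a * T - T\<^sup>2 / 2 + (\<Sum>k\<in>I. \<Delta> k * (T - \<theta> k)))"
    by (intro has_bochner_integral_add has_bochner_integral_diff has_bochner_integral_sum const jump)
  also have "(\<lambda>t. a * indicator {0..<T} t - t * indicator {0..<T} t
        + (\<Sum>k\<in>I. \<Delta> k * indicator {\<theta> k<..<T} t)) =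
      (\<lambda>t. indicator {0..<T} t * (a - t + (\<Sum>k\<in>I. if \<theta> k < t then \<Delta> k else 0)))"
  proof
    fix t
    have "(\<Sum>k\<in>I. \<Delta> k * indicator {\<theta> k<..<T} t) =
        indicator {0..<T} t * (\<Sum>k\<in>I. if \<theta> k < t then \<Delta> k else 0)"
      unfolding sum_distrib_left using assms(2)
      by (intro sum.cong refl) (fastforce simp: indicator_def)
    then show "a * indicator {0..<T} t - t * indicator {0..<T} t
        + (\<Sum>k\<in>I. \<Delta> k * indicator {\<theta> k<..<T} t) =
      indicator {0..<T} t * (a - t + (\<Sum>k\<in>I. if \<theta> k < t then \<Delta> k else 0))"
      by (simp add: algebra_simps)
  qed
  finally show ?thesis .
qed

lemma objective_tau_hat:
  assumes "\<And>i. i \<in> {1..n} \<Longrightarrow> u i \<noteq> 0"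
  shows "objective n T \<beta> l u = (\<Sum>i\<in>{1..n}. (u i)\<^sup>2 / 2 + u i * tau_hat T \<beta> l u i) / T"
proof -
  have "(\<Sum>i\<in>{1..n}. 1 / 2 * (u i)\<^sup>2 + l i * u i
       + (if u i = 0 then 0
          else u i / \<beta> * ln ((1 - exp (- \<beta> * u i)) / (1 - exp (- \<beta> * T))))) =
     (\<Sum>i\<in>{1..n}. (u i)\<^sup>2 / 2 + u i * tau_hat T \<beta> l u i)"
    using assms by (intro sum.cong refl) (auto simp: tau_hat_def algebra_simps)
  then show ?thesis
    by (simp add: objective_def)
qed

text \<open>
  Both halves of the proof end here: the jumps \<open>\<Delta>\<close> come from a given timetable in one case, and are
  prescribed by an optimal solution in the other. The premise \<open>area\<close> is the telescoped sum of the
  differences of squared levels, for \<open>tau_hat T \<beta> l \<Delta> i + \<theta> i\<close> is the level just before the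
  departure of route \<open>i\<close>, and the level rises from \<open>a\<close> to \<open>a + T\<close> over the period.
\<close>

lemma logit_measure_eq_objective:
  assumes "T > 0" "\<beta> > 0" "n \<noteq> 0" "\<theta> \<in> timetables n T"
    and nonzero: "\<And>i. i \<in> {1..n} \<Longrightarrow> \<Delta> i \<noteq> 0"
    and total: "sum \<Delta> {1..n} = T"
    and level: "\<And>t. level T \<beta> l \<theta> {1..n} {i\<in>{1..n}. \<theta> i < t} =
      a + (\<Sum>i\<in>{1..n}. if \<theta> i < t then \<Delta> i else 0)"
    and area: "(\<Sum>i\<in>{1..n}. (\<Delta> i)\<^sup>2 / 2 + \<Delta> i * (tau_hat T \<beta> l \<Delta> i + \<theta> i)) =
      ((a + T)\<^sup>2 - a\<^sup>2) / 2"
  shows "logit_measure n T \<beta> l \<theta> = objective n T \<beta> l \<Delta>"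
proof -
  have "(\<lambda>t. indicator {0..<T} t * logit_cost n T \<beta> l \<theta> t) =
      (\<lambda>t. indicator {0..<T} t * (a - t + (\<Sum>i\<in>{1..n}. if \<theta> i < t then \<Delta> i else 0)))"
    using logit_cost_eq_level[OF assms(2-4)] level by (auto simp: indicator_def fun_eq_iff)
  then have "(\<integral>t. indicator {0..<T} t * logit_cost n T \<beta> l \<theta> t \<partial>lborel) =
      a * T - T\<^sup>2 / 2 + (\<Sum>i\<in>{1..n}. \<Delta> i * (T - \<theta> i))"
    using has_bochner_integral_integral_eq[OF has_bochner_integral_sawtooth[OF assms(1), of "{1..n}" \<theta> a \<Delta>]]
      assms(4) by (simp add: timetables_def Pi_iff)
  also have "(\<Sum>i\<in>{1..n}. \<Delta> i * (T - \<theta> i)) = T\<^sup>2 - (\<Sum>i\<in>{1..n}. \<Delta> i * \<theta> i)"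
    using total by (simp add: algebra_simps sum_subtractf sum_distrib_left[symmetric] power2_eq_square)
  also have "a * T - T\<^sup>2 / 2 + (T\<^sup>2 - (\<Sum>i\<in>{1..n}. \<Delta> i * \<theta> i)) =
      ((a + T)\<^sup>2 - a\<^sup>2) / 2 - (\<Sum>i\<in>{1..n}. \<Delta> i * \<theta> i)"
    by (simp add: power2_eq_square field_simps)
  also have "\<dots> = (\<Sum>i\<in>{1..n}. (\<Delta> i)\<^sup>2 / 2 + \<Delta> i * tau_hat T \<beta> l \<Delta> i)"
    unfolding area[symmetric] by (simp add: sum.distrib distrib_left)
  finally show ?thesis
    using logit_measure_eq_integral[OF assms(1)] objective_tau_hat[of n \<Delta> T \<beta> l, OF nonzero]
    by simp
qed

section \<open>Every timetable attains the objective at its jumps\<close>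

text \<open>
  The departure of \<open>x\<close> lowers the exponential sum \<open>exp (- \<beta> * level)\<close> by
  \<open>exp (- \<beta> * (l x + \<theta> x)) * (1 - exp (- \<beta> * T))\<close>. Dividing by the sum before the departure
  turns this into an equation between the size \<open>d\<close> of the jump and the level from which it starts.
\<close>

lemma level_jump:
  fixes I D :: "nat set" and l \<theta> :: "nat \<Rightarrow> real"
  assumes "T > 0" "\<beta> > 0" "finite I" "x \<in> I" "x \<notin> D"
  defines "d \<equiv> level T \<beta> l \<theta> I (insert x D) - level T \<beta> l \<theta> I D"
  shows "d > 0"
    and "l x + 1 / \<beta> * ln ((1 - exp (- \<beta> * d)) / (1 - exp (- \<beta> * T))) =
      level T \<beta> l \<theta> I D - \<theta> x"
proof -
  let ?L = "level T \<beta> l \<theta> I"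
  let ?w = "exp (- \<beta> * (l x + \<theta> x))"
  define q where "q = 1 - exp (- \<beta> * T)"
  have q: "q > 0"
    using assms(1,2) by (simp add: q_def)
  have ne: "I \<noteq> {}"
    using assms(4) by auto
  have split: "exp (- \<beta> * ?L E) = exp (- \<beta> * (l x + \<theta> x + (if x \<in> E then T else 0))) +
      (\<Sum>i\<in>I - {x}. exp (- \<beta> * (l i + \<theta> i + (if i \<in> E then T else 0))))" for E
    unfolding exp_level[OF assms(2,3) ne] using assms(3,4) by (rule sum.remove)
  have "exp (- \<beta> * ?L D) - exp (- \<beta> * ?L (insert x D)) =
      ?w - exp (- \<beta> * (l x + \<theta> x + T))"
    unfolding split using assms(5) by (auto intro!: sum.cong)
  also have "\<dots> = ?w * q"
    by (simp add: q_def algebra_simps exp_add[symmetric])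
  finally have diff: "exp (- \<beta> * ?L D) - exp (- \<beta> * ?L (insert x D)) = ?w * q" .
  moreover have "?w * q > 0"
    using q by simp
  ultimately have "exp (- \<beta> * ?L (insert x D)) < exp (- \<beta> * ?L D)"
    by linarith
  then show "d > 0"
    using assms(2) by (simp add: d_def)
  have "1 - exp (- \<beta> * d) =
      (exp (- \<beta> * ?L D) - exp (- \<beta> * ?L (insert x D))) * exp (\<beta> * ?L D)"
    by (simp add: d_def algebra_simps exp_add[symmetric])
  also have "\<dots> = exp (\<beta> * (?L D - \<theta> x - l x)) * q"
    unfolding diff by (simp add: algebra_simps exp_add[symmetric])
  finally have "(1 - exp (- \<beta> * d)) / q = exp (\<beta> * (?L D - \<theta> x - l x))"
    using q by simp
  then show "l x + 1 / \<beta> * ln ((1 - exp (- \<beta> * d)) / (1 - exp (- \<beta> * T))) = ?L D - \<theta> x"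
    using assms(2) unfolding q_def by simp
qed

text \<open>
  The routes of \<open>S\<close> are inserted in the order of their departure times, each one contributing its
  own jump. When the latest route \<open>x\<close> is added, the departures before \<open>t\<close> are unchanged if
  \<open>t \<le> \<theta> x\<close>, and are all of \<open>S\<close> and \<open>x\<close> otherwise; ties are broken by the order of insertion.
\<close>

lemma jumps_of_timetable:
  assumes "T > 0" "\<beta> > 0" "finite I" "S \<subseteq> I"
  shows "\<exists>\<Delta>. (\<forall>i\<in>S. \<Delta> i > 0) \<and>
    sum \<Delta> S = level T \<beta> l \<theta> I S - level T \<beta> l \<theta> I {} \<and>
    (\<forall>t. level T \<beta> l \<theta> I {i\<in>S. \<theta> i < t} =
      level T \<beta> l \<theta> I {} + (\<Sum>i\<in>S. if \<theta> i < t then \<Delta> i else 0)) \<and>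
    (\<Sum>i\<in>S. (\<Delta> i)\<^sup>2 / 2 + \<Delta> i * (tau_hat T \<beta> l \<Delta> i + \<theta> i)) =
      ((level T \<beta> l \<theta> I S)\<^sup>2 - (level T \<beta> l \<theta> I {})\<^sup>2) / 2"
    (is "\<exists>\<Delta>. ?P S \<Delta>")
proof -
  have "finite S"
    using assms(3,4) by (rule finite_subset[rotated])
  then show ?thesis
    using assms(4)
  proof (induction S rule: finite_ranking_induct[where f = \<theta>])
    case empty
    show ?case
      by simp
  next
    case (insert x S)
    show ?case
    proof (cases "x \<in> S")
      case True
      then show ?thesis
        using insert by (simp add: insert_absorb)
    next
      case False
      let ?L = "level T \<beta> l \<theta> I"
      obtain \<Delta> where \<Delta>: "?P S \<Delta>"
        using insert by auto
      define d where "d = ?L (insert x S) - ?L S"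
      have x: "x \<in> I"
        using insert by auto
      note jump = level_jump[OF assms(1-3) x False, of l \<theta>, folded d_def]
      define \<Delta>' where "\<Delta>' = \<Delta>(x := d)"
      have \<Delta>'_S: "\<Delta>' i = \<Delta> i" if "i \<in> S" for i
        using that False by (auto simp: \<Delta>'_def)
      have \<Delta>'_x: "\<Delta>' x = d"
        by (simp add: \<Delta>'_def)
      have "?P (insert x S) \<Delta>'"
      proof (intro conjI ballI allI)
        show "\<Delta>' i > 0" if "i \<in> insert x S" for i
          using that \<Delta> jump(1) \<Delta>'_S \<Delta>'_x by auto
        have "sum \<Delta>' S = sum \<Delta> S"
          by (intro sum.cong refl \<Delta>'_S)
        then show "sum \<Delta>' (insert x S) = ?L (insert x S) - ?L {}"
          using \<Delta> insert(1) False by (simp add: \<Delta>'_x d_def)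
      next
        fix t
        have 1: "(\<Sum>i\<in>S. if \<theta> i < t then \<Delta>' i else 0) = (\<Sum>i\<in>S. if \<theta> i < t then \<Delta> i else 0)"
          by (intro sum.cong refl) (simp add: \<Delta>'_S)
        show "?L {i\<in>insert x S. \<theta> i < t} =
            ?L {} + (\<Sum>i\<in>insert x S. if \<theta> i < t then \<Delta>' i else 0)"
        proof (cases "\<theta> x < t")
          case True
          then have below: "\<theta> i < t" if "i \<in> S" for i
            using insert(2)[OF that] by simp
          then have "{i\<in>insert x S. \<theta> i < t} = insert x S"
            using True by auto
          moreover have "(\<Sum>i\<in>S. if \<theta> i < t then \<Delta> i else 0) = sum \<Delta> S"
            using below by (intro sum.cong) auto
          ultimately show ?thesis
            using True \<Delta> insert(1) False 1 by (simp add: \<Delta>'_x d_def)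
        next
          case not_less: False
          then have "{i\<in>insert x S. \<theta> i < t} = {i\<in>S. \<theta> i < t}"
            by auto
          then show ?thesis
            using not_less \<Delta> insert(1) False 1 by simp
        qed
      next
        have 1: "(\<Sum>i\<in>S. (\<Delta>' i)\<^sup>2 / 2 + \<Delta>' i * (tau_hat T \<beta> l \<Delta>' i + \<theta> i)) =
            (\<Sum>i\<in>S. (\<Delta> i)\<^sup>2 / 2 + \<Delta> i * (tau_hat T \<beta> l \<Delta> i + \<theta> i))"
          by (intro sum.cong refl) (simp add: \<Delta>'_S tau_hat_def)
        have 2: "tau_hat T \<beta> l \<Delta>' x + \<theta> x = ?L S"
          using jump(2) by (simp add: tau_hat_def \<Delta>'_x)
        have "(\<Sum>i\<in>insert x S. (\<Delta>' i)\<^sup>2 / 2 + \<Delta>' i * (tau_hat T \<beta> l \<Delta>' i + \<theta> i)) =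
            d\<^sup>2 / 2 + d * ?L S + ((?L S)\<^sup>2 - (?L {})\<^sup>2) / 2"
          using insert(1) False \<Delta> 1 2 by (simp add: \<Delta>'_x)
        also have "d\<^sup>2 / 2 + d * ?L S = ((?L (insert x S))\<^sup>2 - (?L S)\<^sup>2) / 2"
          by (simp add: d_def power2_eq_square field_simps)
        finally show "(\<Sum>i\<in>insert x S. (\<Delta>' i)\<^sup>2 / 2 + \<Delta>' i * (tau_hat T \<beta> l \<Delta>' i + \<theta> i)) =
            ((?L (insert x S))\<^sup>2 - (?L {})\<^sup>2) / 2"
          by (simp add: field_simps)
      qed
      then show ?thesis
        by blast
    qed
  qed
qed

lemma logit_measure_attained_by_feasible:
  assumes "T > 0" "\<beta> > 0" "n \<noteq> 0" "\<theta> \<in> timetables n T"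
  obtains \<Delta> where "\<Delta> \<in> feasible n T" "logit_measure n T \<beta> l \<theta> = objective n T \<beta> l \<Delta>"
proof -
  have all: "level T \<beta> l \<theta> {1..n} {1..n} = level T \<beta> l \<theta> {1..n} {} + T"
    using assms(2,3) by (intro level_all) auto
  obtain \<Delta> where pos: "\<forall>i\<in>{1..n}. \<Delta> i > 0" and total: "sum \<Delta> {1..n} = T"
    and "\<And>t. level T \<beta> l \<theta> {1..n} {i\<in>{1..n}. \<theta> i < t} =
      level T \<beta> l \<theta> {1..n} {} + (\<Sum>i\<in>{1..n}. if \<theta> i < t then \<Delta> i else 0)"
    and "(\<Sum>i\<in>{1..n}. (\<Delta> i)\<^sup>2 / 2 + \<Delta> i * (tau_hat T \<beta> l \<Delta> i + \<theta> i)) =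
      ((level T \<beta> l \<theta> {1..n} {} + T)\<^sup>2 - (level T \<beta> l \<theta> {1..n} {})\<^sup>2) / 2"
    using jumps_of_timetable[OF assms(1,2), of "{1..n}" "{1..n}" l \<theta>] unfolding all by auto
  then have "logit_measure n T \<beta> l \<theta> = objective n T \<beta> l \<Delta>"
    by (intro logit_measure_eq_objective[OF assms, where a = "level T \<beta> l \<theta> {1..n} {}"]) force+
  moreover have "\<Delta> \<in> feasible n T"
    using pos total by (auto simp: feasible_def less_imp_le)
  ultimately show ?thesis
    using that by blast
qed

section \<open>Optimality conditions\<close>

text \<open>The contribution of a single route with duration \<open>c\<close> to \<open>T\<close> times the objective.\<close>

definition route_term :: "real \<Rightarrow> real \<Rightarrow> real \<Rightarrow> real \<Rightarrow> real" where
  "route_term T \<beta> c u = 1 / 2 * u\<^sup>2 + c * u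
     + (if u = 0 then 0 else u / \<beta> * ln ((1 - exp (- \<beta> * u)) / (1 - exp (- \<beta> * T))))"

text \<open>
  Moving an amount \<open>s\<close> from route \<open>j\<close> to route \<open>i\<close> preserves feasibility and changes only two
  summands. This reduces everything needed about optimality to functions of one variable.
\<close>

lemma optimal_transfer:
  assumes "T > 0" and opt: "is_arg_min (objective n T \<beta> l) (\<lambda>u. u \<in> feasible n T) y"
    and i: "i \<in> {1..n}" and j: "j \<in> {1..n}" and "i \<noteq> j" and "y i + s \<ge> 0" "y j - s \<ge> 0"
  shows "route_term T \<beta> (l i) (y i) + route_term T \<beta> (l j) (y j) \<le>
    route_term T \<beta> (l i) (y i + s) + route_term T \<beta> (l j) (y j - s)"
proof -
  define u where "u = y(i := y i + s, j := y j - s)"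
  have y: "y \<in> feasible n T" and le: "\<And>v. v \<in> feasible n T \<Longrightarrow> objective n T \<beta> l y \<le> objective n T \<beta> l v"
    using opt by (auto simp: is_arg_min_def not_less)
  have split: "(\<Sum>k\<in>{1..n}. f k) = f i + f j + (\<Sum>k\<in>{1..n} - {i, j}. f k)" for f :: "nat \<Rightarrow> real"
  proof -
    have "(\<Sum>k\<in>{1..n}. f k) = (\<Sum>k\<in>{i, j}. f k) + (\<Sum>k\<in>{1..n} - {i, j}. f k)"
      using i j by (subst add.commute, intro sum.subset_diff) auto
    then show ?thesis
      using assms(5) by simp
  qed
  have rest: "(\<Sum>k\<in>{1..n} - {i, j}. f k (u k)) = (\<Sum>k\<in>{1..n} - {i, j}. f k (y k))"
    for f :: "nat \<Rightarrow> real \<Rightarrow> real"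
    by (intro sum.cong) (auto simp: u_def)
  have obj: "objective n T \<beta> l v = (\<Sum>k\<in>{1..n}. route_term T \<beta> (l k) (v k)) / T" for v
    by (simp add: objective_def route_term_def)
  have "sum u {1..n} = sum y {1..n}"
    using rest[of "\<lambda>k v. v"] assms(5) unfolding split[of u] split[of y] by (simp add: u_def)
  then have "u \<in> feasible n T"
    using y assms(6,7) by (auto simp: feasible_def u_def)
  then have "(\<Sum>k\<in>{1..n}. route_term T \<beta> (l k) (y k)) \<le> (\<Sum>k\<in>{1..n}. route_term T \<beta> (l k) (u k))"
    using le[of u] assms(1) by (simp add: obj divide_le_cancel)
  then show ?thesis
    using rest[of "\<lambda>k. route_term T \<beta> (l k)"] assms(5)
    unfolding split[of "\<lambda>k. route_term T \<beta> (l k) (y k)"] split[of "\<lambda>k. route_term T \<beta> (l k) (u k)"]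
    by (simp add: u_def)
qed

text \<open>
  The marginal cost of \<open>u\<close> in excess of \<open>tau_hat\<close>: it collects the derivative \<open>u\<close> of \<open>u\<^sup>2 / 2\<close> and the
  term \<open>u * exp (- \<beta> * u) / (1 - exp (- \<beta> * u))\<close> that comes from differentiating the logarithm.
\<close>

definition markup :: "real \<Rightarrow> real \<Rightarrow> real" where
  "markup \<beta> u = u / (1 - exp (- \<beta> * u))"

text \<open>
  Both bounds are instances of \<open>1 + x < exp x\<close>, at \<open>x = - \<beta> * u\<close> and at \<open>x = \<beta> * u\<close>. The two
  bounds differ by exactly \<open>u\<close>, which is what makes the departures of the constructed timetable
  come in order.
\<close>

lemma markup_bounds:
  assumes "\<beta> > 0" "u > 0"
  shows "1 / \<beta> < markup \<beta> u" "markup \<beta> u < u + 1 / \<beta>"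
proof -
  have q: "1 - exp (- \<beta> * u) > 0"
    using assms by simp
  have "exp (- \<beta> * u) > 1 + - \<beta> * u"
    using assms exp_minus_greater[of "\<beta> * u"] by simp
  then show "1 / \<beta> < markup \<beta> u"
    using q assms by (simp add: markup_def field_simps)
  have "(\<beta> * u + 1) * exp (- \<beta> * u) < exp (\<beta> * u) * exp (- \<beta> * u)"
    using assms exp_minus_greater[of "- (\<beta> * u)"] by (intro mult_strict_right_mono) auto
  then have "(\<beta> * u + 1) * exp (- \<beta> * u) < 1"
    by (simp add: exp_add[symmetric])
  then show "markup \<beta> u < u + 1 / \<beta>"
    using q assms by (simp add: markup_def field_simps)
qed

lemma route_term_has_derivative:
  assumes "T > 0" "\<beta> > 0" "u > 0"
  shows "(route_term T \<beta> c has_real_derivative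
    c + 1 / \<beta> * ln ((1 - exp (- \<beta> * u)) / (1 - exp (- \<beta> * T))) + markup \<beta> u) (at u)"
proof -
  have q: "1 - exp (- \<beta> * T) > 0" "1 - exp (- \<beta> * u) > 0"
    using assms by auto
  have "((\<lambda>u. 1 / 2 * u\<^sup>2 + c * u + u / \<beta> * ln ((1 - exp (- \<beta> * u)) / (1 - exp (- \<beta> * T))))
      has_real_derivative
      c + 1 / \<beta> * ln ((1 - exp (- \<beta> * u)) / (1 - exp (- \<beta> * T))) + markup \<beta> u) (at u)"
    using assms q
    by (auto intro!: derivative_eq_intros simp: markup_def divide_simps) (simp add: algebra_simps)
  then show ?thesis
  proof (rule has_field_derivative_transform_within_open[where S = "{0<..}"])
  qed (use assms in \<open>auto simp: route_term_def\<close>)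
qed

lemma route_term_slope_at_0:
  assumes "T > 0" "\<beta> > 0"
  shows "filterlim (\<lambda>s. route_term T \<beta> c s / s) at_bot (at_right 0)"
proof -
  define q where "q = 1 - exp (- \<beta> * T)"
  have "q > 0"
    using assms by (simp add: q_def)
  then have "filterlim (\<lambda>s. 1 / 2 * s + c + 1 / \<beta> * ln ((1 - exp (- \<beta> * s)) / q)) at_bot (at_right 0)"
    using assms by real_asymp
  moreover have "\<forall>\<^sub>F s in at_right 0.
      route_term T \<beta> c s / s = 1 / 2 * s + c + 1 / \<beta> * ln ((1 - exp (- \<beta> * s)) / q)"
    unfolding q_def
    by (intro eventually_at_right_less[THEN eventually_mono])
       (auto simp: route_term_def field_simps power2_eq_square)
  ultimately show ?thesis
    by (simp add: filterlim_cong)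
qed

text \<open>
  If \<open>y i = 0\<close>, some other \<open>y j\<close> is positive, and a small transfer from \<open>j\<close> to \<open>i\<close> gains more on
  route \<open>i\<close>, where the slope is \<open>-\<infinity>\<close>, than it can lose on route \<open>j\<close>, where the slope is
  finite.
\<close>

lemma optimal_positive:
  assumes "T > 0" "\<beta> > 0" and opt: "is_arg_min (objective n T \<beta> l) (\<lambda>u. u \<in> feasible n T) y"
    and i: "i \<in> {1..n}"
  shows "y i > 0"
proof (rule ccontr)
  have y: "sum y {1..n} = T" "\<And>k. k \<in> {1..n} \<Longrightarrow> y k \<ge> 0"
    using opt by (auto simp: is_arg_min_def feasible_def)
  assume "\<not> y i > 0"
  then have yi: "y i = 0"
    using y(2)[OF i] by simp
  have "\<exists>j\<in>{1..n}. y j > 0"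
    using y assms(1) sum_nonpos[of "{1..n}" y] by force
  then obtain j where j: "j \<in> {1..n}" "y j > 0"
    by blast
  then have ij: "i \<noteq> j"
    using yi by auto
  obtain D where D: "(route_term T \<beta> (l j) has_real_derivative D) (at (y j))"
    using route_term_has_derivative[OF assms(1,2) j(2)] by blast
  have "((\<lambda>s. y j - s) has_real_derivative - 1) (at 0)"
    by (auto intro!: derivative_eq_intros)
  then have "((\<lambda>s. route_term T \<beta> (l j) (y j - s)) has_real_derivative D * - 1) (at 0)"
    by (rule DERIV_chain') (simp add: D)
  then have "((\<lambda>s. route_term T \<beta> (l j) (y j - s)) has_real_derivative - D) (at_right 0)"
    by (simp add: has_field_derivative_at_within)
  then have "((\<lambda>s. (route_term T \<beta> (l j) (y j - s) - route_term T \<beta> (l j) (y j)) / s) \<longlongrightarrow> - D) (at_right 0)"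
    by (simp add: has_field_derivative_iff)
  moreover note route_term_slope_at_0[OF assms(1,2), of "l i"]
  ultimately have "filterlim (\<lambda>s. route_term T \<beta> (l i) s / s +
      (route_term T \<beta> (l j) (y j - s) - route_term T \<beta> (l j) (y j)) / s) at_bot (at_right 0)"
    by (subst add.commute) (simp add: filterlim_tendsto_add_at_bot_iff)
  then have "\<forall>\<^sub>F s in at_right 0. route_term T \<beta> (l i) s / s +
      (route_term T \<beta> (l j) (y j - s) - route_term T \<beta> (l j) (y j)) / s < 0"
    by (simp add: filterlim_at_bot_dense)
  moreover have "\<forall>\<^sub>F s in at_right 0. 0 < s \<and> s < y j"
    using j(2) by (auto simp: eventually_at_right_field)
  ultimately have "\<forall>\<^sub>F s in at_right (0 :: real). False"
  proof eventually_elim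
    case (elim s)
    then have "route_term T \<beta> (l i) s + route_term T \<beta> (l j) (y j - s) < route_term T \<beta> (l j) (y j)"
      by (simp add: field_simps)
    moreover have "route_term T \<beta> (l i) 0 = 0"
      by (simp add: route_term_def)
    ultimately show False
      using optimal_transfer[OF assms(1) opt i j(1) ij, of s] elim yi by simp
  qed
  then show False
    by simp
qed

lemma optimal_stationary:
  assumes "T > 0" "\<beta> > 0" and opt: "is_arg_min (objective n T \<beta> l) (\<lambda>u. u \<in> feasible n T) y"
    and i: "i \<in> {1..n}" and j: "j \<in> {1..n}"
  shows "tau_hat T \<beta> l y i + markup \<beta> (y i) = tau_hat T \<beta> l y j + markup \<beta> (y j)"
proof (cases "i = j")
  case False
  note pos = optimal_positive[OF assms(1-3)]
  let ?D = "\<lambda>k. tau_hat T \<beta> l y k + markup \<beta> (y k)"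
  have deriv: "(route_term T \<beta> (l k) has_real_derivative ?D k) (at (y k))" if "k \<in> {1..n}" for k
    using route_term_has_derivative[OF assms(1,2) pos[OF that]] by (simp add: tau_hat_def)
  have "((\<lambda>s. route_term T \<beta> (l i) (y i + s) + route_term T \<beta> (l j) (y j - s))
      has_real_derivative ?D i - ?D j) (at 0)"
    using deriv[OF i] deriv[OF j]
    by (auto intro!: derivative_eq_intros DERIV_chain'[where g = "route_term T \<beta> (l i)"]
        DERIV_chain'[where g = "route_term T \<beta> (l j)"])
  moreover have "0 < min (y i) (y j)"
    using pos i j by simp
  moreover have "\<forall>s. \<bar>0 - s\<bar> < min (y i) (y j) \<longrightarrow>
      route_term T \<beta> (l i) (y i + 0) + route_term T \<beta> (l j) (y j - 0) \<le>
      route_term T \<beta> (l i) (y i + s) + route_term T \<beta> (l j) (y j - s)"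
    using optimal_transfer[OF assms(1) opt i j False] by auto
  ultimately have "?D i - ?D j = 0"
    by (rule DERIV_local_min)
  then show ?thesis
    by simp
qed simp

section \<open>The timetable built from an optimal solution\<close>

text \<open>
  Read with \<open>level\<close> in mind, this says that the level before the departure of route \<open>k\<close> ought to be
  the initial level \<open>tau_hat T \<beta> l y 1\<close> plus the jumps of the routes before \<open>k\<close>.
\<close>

lemma time_table_logit_telescope:
  assumes "k \<ge> 1"
  shows "time_table_logit T \<beta> l y k + tau_hat T \<beta> l y k = tau_hat T \<beta> l y 1 + sum y {1..<k}"
  using assms
proof (induction k rule: dec_induct)
  case base
  show ?case by simp
next
  case (step k)
  then obtain m where "k = Suc m"
    by (cases k) auto
  with step.IH show ?case
    by (simp add: delta_hat_def)
qed

lemma time_table_logit_strict_increasing: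
  assumes "T > 0" "\<beta> > 0" and opt: "is_arg_min (objective n T \<beta> l) (\<lambda>u. u \<in> feasible n T) y"
    and "1 \<le> i" "i < j" "j \<le> n"
  shows "time_table_logit T \<beta> l y i < time_table_logit T \<beta> l y j"
proof -
  note pos = optimal_positive[OF assms(1-3)]
  have "1 / \<beta> < markup \<beta> (y j)" "markup \<beta> (y i) < y i + 1 / \<beta>"
    using markup_bounds[OF assms(2)] pos assms(4-6) by auto
  moreover have "tau_hat T \<beta> l y i + markup \<beta> (y i) = tau_hat T \<beta> l y j + markup \<beta> (y j)"
    using optimal_stationary[OF assms(1-3)] assms(4-6) by auto
  moreover have "sum y {1..<j} = sum y {1..<i} + sum y {i..<j}"
    using assms(4-6) by (simp add: sum.atLeastLessThan_concat)
  moreover have "y i \<le> sum y {i..<j}"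
    using assms(4-6) pos by (intro member_le_sum) (auto simp: less_imp_le)
  ultimately show ?thesis
    using time_table_logit_telescope[of i T \<beta> l y] time_table_logit_telescope[of j T \<beta> l y] assms(4-6)
    by linarith
qed

text \<open>
  The bound \<open>\<theta> k < T\<close> is the positivity of the gap between the last departure and the first
  departure of the next period, obtained from the same bounds on the markup as the other gaps.
\<close>

lemma time_table_logit_timetable:
  assumes "T > 0" "\<beta> > 0" and opt: "is_arg_min (objective n T \<beta> l) (\<lambda>u. u \<in> feasible n T) y"
  shows "time_table_logit T \<beta> l y \<in> timetables n T"
  unfolding timetables_def
proof
  fix k assume k: "k \<in> {1..n}"
  let ?\<theta> = "time_table_logit T \<beta> l y"
  note pos = optimal_positive[OF assms]
  have "?\<theta> 1 = 0"
    by simp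
  moreover have "?\<theta> 1 \<le> ?\<theta> k"
    using time_table_logit_strict_increasing[OF assms, of 1 k] k by (cases "k = 1") auto
  moreover have "?\<theta> k < T"
  proof -
    have "1 / \<beta> < markup \<beta> (y 1)" "markup \<beta> (y k) < y k + 1 / \<beta>"
      using markup_bounds[OF assms(2)] pos k by auto
    moreover have "tau_hat T \<beta> l y 1 + markup \<beta> (y 1) = tau_hat T \<beta> l y k + markup \<beta> (y k)"
      using k by (intro optimal_stationary[OF assms]) auto
    moreover have "sum y {1..<k} + y k = sum y {1..<Suc k}"
      using k by (simp add: sum.atLeastLessThan_Suc)
    moreover have "sum y {1..<Suc k} \<le> sum y {1..n}"
      using k pos by (intro sum_mono2) (auto simp: less_imp_le)
    moreover have "sum y {1..n} = T"
      using opt by (simp add: is_arg_min_def feasible_def)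
    moreover have "?\<theta> k + tau_hat T \<beta> l y k = tau_hat T \<beta> l y 1 + sum y {1..<k}"
      using k by (intro time_table_logit_telescope) simp
    ultimately show ?thesis
      by linarith
  qed
  ultimately show "?\<theta> k \<in> {0..<T}"
    by simp
qed

text \<open>
  The prescribed level \<open>B\<close> and the actual one produce the same decrease of \<open>exp (- \<beta> * level)\<close> at each
  departure. Over the whole period both sums shrink by the factor \<open>exp (- \<beta> * T)\<close>, because the
  jumps add up to \<open>T\<close>; so the total decrease determines the initial value, and the two
  levels agree from the start.
\<close>

lemma time_table_logit_level:
  assumes "T > 0" "\<beta> > 0" and pos: "\<And>i. i \<in> {1..n} \<Longrightarrow> y i > 0" and total: "sum y {1..n} = T"
    and "k \<le> n"
  shows "level T \<beta> l (time_table_logit T \<beta> l y) {1..n} {1..k} = tau_hat T \<beta> l y 1 + sum y {1..k}"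
proof -
  let ?\<theta> = "time_table_logit T \<beta> l y"
  define B where "B m = tau_hat T \<beta> l y 1 + sum y {1..m}" for m
  define q where "q = 1 - exp (- \<beta> * T)"
  have q: "q > 0"
    using assms(1,2) by (simp add: q_def)
  define w where "w i = exp (- \<beta> * (l i + ?\<theta> i))" for i
  have drop: "exp (- \<beta> * B (m - 1)) - exp (- \<beta> * B m) = w m * q" if m: "m \<in> {1..n}" for m
  proof -
    have Bm: "B (m - 1) = ?\<theta> m + tau_hat T \<beta> l y m"
      using time_table_logit_telescope[of m T \<beta> l y] m
      by (cases m) (auto simp: B_def atLeastLessThanSuc_atLeastAtMost)
    have "B m = B (m - 1) + y m"
      using m by (cases m) (auto simp: B_def)
    then have "exp (- \<beta> * B (m - 1)) - exp (- \<beta> * B m) =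
        exp (- \<beta> * B (m - 1)) * (1 - exp (- \<beta> * y m))"
      by (simp add: algebra_simps exp_add[symmetric])
    also have "1 - exp (- \<beta> * y m) = q * exp (\<beta> * (tau_hat T \<beta> l y m - l m))"
      using pos[OF m] assms(1,2) q by (simp add: tau_hat_def q_def)
    also have "exp (- \<beta> * B (m - 1)) * (q * exp (\<beta> * (tau_hat T \<beta> l y m - l m))) = w m * q"
      unfolding Bm w_def by (simp add: algebra_simps exp_add[symmetric])
    finally show ?thesis .
  qed
  have upto: "exp (- \<beta> * B 0) - exp (- \<beta> * B m) = (\<Sum>i\<in>{1..m}. w i) * q" if "m \<le> n" for m
    using that
  proof (induction m)
    case (Suc m)
    then show ?case
      using drop[of "Suc m"] by (simp add: algebra_simps)
  qed simp
  have "exp (- \<beta> * B n) = exp (- \<beta> * B 0) * (1 - q)"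
    using total by (simp add: B_def q_def exp_add[symmetric] algebra_simps)
  then have "exp (- \<beta> * B 0) * q = (\<Sum>i\<in>{1..n}. w i) * q"
    using upto[of n] by (simp add: algebra_simps)
  then have B0: "exp (- \<beta> * B 0) = (\<Sum>i\<in>{1..n}. w i)"
    using q by simp
  have "(\<Sum>i\<in>{1..n}. exp (- \<beta> * (l i + ?\<theta> i + (if i \<in> {1..k} then T else 0)))) =
      (\<Sum>i\<in>{1..n}. w i - (if i \<in> {1..k} then w i * q else 0))"
    by (intro sum.cong refl) (auto simp: w_def q_def algebra_simps exp_add[symmetric])
  also have "\<dots> = (\<Sum>i\<in>{1..n}. w i) - (\<Sum>i\<in>{1..k}. w i * q)"
  proof -
    have "(\<Sum>i\<in>{1..n}. if i \<in> {1..k} then w i * q else 0) = (\<Sum>i\<in>{1..k}. w i * q)"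
      using assms(5) by (intro sum.mono_neutral_cong_right) auto
    then show ?thesis
      by (simp only: sum_subtractf)
  qed
  also have "\<dots> = exp (- \<beta> * B k)"
    using upto[OF assms(5)] B0 by (simp add: sum_distrib_right)
  finally show ?thesis
    using level_eqI[OF assms(2)] by (metis B_def)
qed

lemma logit_measure_time_table_logit:
  assumes "T > 0" "\<beta> > 0" and opt: "is_arg_min (objective n T \<beta> l) (\<lambda>u. u \<in> feasible n T) y"
  shows "logit_measure n T \<beta> l (time_table_logit T \<beta> l y) = objective n T \<beta> l y"
proof -
  let ?\<theta> = "time_table_logit T \<beta> l y"
  define a where "a = tau_hat T \<beta> l y 1"
  note pos = optimal_positive[OF assms]
  have total: "sum y {1..n} = T"
    using opt by (simp add: is_arg_min_def feasible_def)
  then have "n \<noteq> 0"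
    using assms(1) by (intro notI) simp
  then show ?thesis
  proof (rule logit_measure_eq_objective[OF assms(1,2) _ time_table_logit_timetable[OF assms] _ total,
        where a = a])
    show "y i \<noteq> 0" if "i \<in> {1..n}" for i
      using pos[OF that] by simp
  next
    fix t
    let ?D = "{i\<in>{1..n}. ?\<theta> i < t}"
    \<comment> \<open>The departure times increase, so the routes departed before \<open>t\<close> form an initial segment.\<close>
    have "\<exists>k\<le>n. ?D = {1..k}"
    proof (cases "?D = {}")
      case False
      define M where "M = Max ?D"
      have M: "M \<in> ?D"
        unfolding M_def using False by (intro Max_in) auto
      have "?D = {1..M}"
      proof (intro equalityI subsetI)
        fix i assume "i \<in> ?D"
        then show "i \<in> {1..M}"
          by (auto simp: M_def intro!: Max_ge)
      next
        fix i assume i: "i \<in> {1..M}"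
        then have "?\<theta> i \<le> ?\<theta> M"
          using time_table_logit_strict_increasing[OF assms, of i M] M by (cases "i = M") auto
        then show "i \<in> ?D"
          using i M by auto
      qed
      moreover have "M \<le> n"
        using M by simp
      ultimately show ?thesis
        by blast
    qed (auto intro!: exI[of _ 0])
    then obtain k where k: "k \<le> n" "?D = {1..k}"
      by blast
    have "(\<Sum>i\<in>{1..n}. if ?\<theta> i < t then y i else 0) = sum y ?D"
      by (rule sum.inter_filter[symmetric]) simp
    then show "level T \<beta> l ?\<theta> {1..n} ?D = a + (\<Sum>i\<in>{1..n}. if ?\<theta> i < t then y i else 0)"
      using time_table_logit_level[OF assms(1,2) pos total k(1), of l] k(2) by (simp add: a_def)
  next
    have "(\<Sum>i\<in>{1..m}. (y i)\<^sup>2 / 2 + y i * (tau_hat T \<beta> l y i + ?\<theta> i)) =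
        ((a + sum y {1..m})\<^sup>2 - a\<^sup>2) / 2" for m
    proof (induction m)
      case (Suc m)
      have "tau_hat T \<beta> l y (Suc m) + ?\<theta> (Suc m) = a + sum y {1..m}"
        using time_table_logit_telescope[of "Suc m" T \<beta> l y]
        by (simp add: a_def atLeastLessThanSuc_atLeastAtMost)
      then have "(\<Sum>i\<in>{1..Suc m}. (y i)\<^sup>2 / 2 + y i * (tau_hat T \<beta> l y i + ?\<theta> i)) =
          ((a + sum y {1..m})\<^sup>2 - a\<^sup>2) / 2 +
          ((y (Suc m))\<^sup>2 / 2 + y (Suc m) * (a + sum y {1..m}))"
        using Suc.IH by simp
      also have "\<dots> = ((a + (sum y {1..m} + y (Suc m)))\<^sup>2 - a\<^sup>2) / 2"
        by (simp add: power2_eq_square field_simps)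
      finally show ?case
        by simp
    qed simp
    from this[of n] show "(\<Sum>i\<in>{1..n}. (y i)\<^sup>2 / 2 + y i * (tau_hat T \<beta> l y i + ?\<theta> i)) =
        ((a + T)\<^sup>2 - a\<^sup>2) / 2"
      unfolding total .
  qed
qed

theorem proposition15:
  fixes n :: nat and T \<beta> :: real and l y \<theta> :: "nat \<Rightarrow> real"
  assumes "T > 0" and "\<beta> > 0"
    and "is_arg_min (objective n T \<beta> l) (\<lambda>u. u \<in> feasible n T) y"
    and "\<theta> = time_table_logit T \<beta> l y"
  shows "is_arg_min (logit_measure n T \<beta> l) (\<lambda>\<phi>. \<phi> \<in> timetables n T) \<theta>
    \<and> logit_measure n T \<beta> l \<theta> = (LEAST v. v \<in> objective n T \<beta> l ` feasible n T)"
proof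
  have y: "y \<in> feasible n T"
    and min: "\<And>u. u \<in> feasible n T \<Longrightarrow> objective n T \<beta> l y \<le> objective n T \<beta> l u"
    using assms(3) by (auto simp: is_arg_min_def not_less)
  then have n: "n \<noteq> 0"
    using assms(1) by (intro notI) (simp add: feasible_def)
  have value_\<theta>: "logit_measure n T \<beta> l \<theta> = objective n T \<beta> l y"
    unfolding assms(4) using assms(1-3) by (rule logit_measure_time_table_logit)
  have "logit_measure n T \<beta> l \<theta> \<le> logit_measure n T \<beta> l \<phi>" if \<phi>: "\<phi> \<in> timetables n T" for \<phi>
  proof -
    obtain \<Delta> where "\<Delta> \<in> feasible n T" "logit_measure n T \<beta> l \<phi> = objective n T \<beta> l \<Delta>"
      using logit_measure_attained_by_feasible[OF assms(1,2) n \<phi>] .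
    then show ?thesis
      using min value_\<theta> by simp
  qed
  then show "is_arg_min (logit_measure n T \<beta> l) (\<lambda>\<phi>. \<phi> \<in> timetables n T) \<theta>"
    unfolding is_arg_min_linorder using time_table_logit_timetable[OF assms(1-3)] assms(4) by simp
  show "logit_measure n T \<beta> l \<theta> = (LEAST v. v \<in> objective n T \<beta> l ` feasible n T)"
    unfolding value_\<theta> using y min by (intro Least_equality[symmetric]) auto
qed

end
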